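(* The following hold. (i) For the complete graph $K_n$ on $n$ vertices, $\#TDDP(K_n)=\lfloor n/2\rfloor$ for all $n>1$. (ii) For the cycle $C_n$ on $n$ vertices, $\#TDDP(C_n)=1$ for all $n>2$. (iii) For the enhanced cycle $EC_n$ with $n$ odd, $\#TDDP(EC_n)=2$ for all odd $n>2$. (iv) For the even cycle with diameter chords $CC_{2n}$, $\#TDDP(CC_{2n})=2$ for $2<n<6$ and for $n=7$; and $\#TDDP(CC_{2n})=3$ for all $n\geq 6$ except $n=7$. (v) For the rectangular grid graph $RGG_{m,n}$, $\#TDDP(RGG_{m,n})=1$. (vi) For the complete bipartite graph $B_{m,n}$ with $m\geq n$: $\#TDDP(B_{m,n})=n$ if $m\geq 2n$, and $\#TDDP(B_{m,n})=\lfloor (m+n)/3\rfloor$ if $m<2n$.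
   Context: All graphs are simple and connected. The diameter of $G$ is the greatest distance between any pair of vertices; a diametral path is a shortest path connecting two vertices whose distance equals the diameter. Two paths are totally disjoint if they have no vertex in common, including their end vertices. $\#TDDP(G)$ denotes the maximum size of a set of pairwise totally disjoint diametral paths in $G$. Graph classes. The cycle $C_n$ has distinct vertices $v_0,\dots,v_{n-1}$, edges $(v_i,v_{i+1})$ for $0\le i<n-1$, and edge $(v_{n-1},v_0)$. For odd $n$, $EC_n$ is $C_n$ together with one new vertex $u$ and the two edges $(v_{\lfloor n/2\rfloor},u)$ and $(u,v_{\lceil n/2\rceil+1})$. For $n>1$, $CC_{2n}$ has $2n$ vertices $v_0,\dots,v_{2n-1}$, edges $(v_i,v_{i+1})$ for $0\le i<2n-1$, edge $(v_{2n-1},v_0)$, and chordal edges $(v_i,v_{i+n})$ for $i<n$. $RGG_{m,n}$ has as vertices the points of the plane with integer coordinates, with $x$-coordinates in the range $1,\dots,n$ and $y$-coordinates in the range $1,\dots,m$, two vertices being adjacent whenever the corresponding points are at distance $1$ in the plane. $B_{m,n}$ consists of two sets of vertices of sizes $m$ and $n$, where every vertex of each set is adjacent to every vertex of the other set, with no edges between vertices in the same set.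
   Formalization: In (iii) n=3 is excluded, since EC_3 needs the vertex v_3, which C_3 lacks; in (vi) m,n≥1 is assumed and m=n=1 is excluded, since B_{1,1}=K_2 has #TDDP=1 while the formula gives 0; in (v) m,n≥1. *)

theory Defs
  imports
    "Graph_Theory.Graph_Theory"
    "HOL-Analysis.Product_Vector"
begin

text \<open>
  As in \<^theory>\<open>Graph_Theory.Kuratowski\<close>, undirected graphs are symmetric digraphs.
  Distances are those of \<^theory>\<open>Graph_Theory.Shortest_Path\<close> with all arc weights 1.
\<close>

definition graph_dist :: "('a, 'b) pre_digraph \<Rightarrow> 'a \<Rightarrow> 'a \<Rightarrow> ereal" where
  "graph_dist G u v = wf_digraph.\<mu> G (\<lambda>_. 1) u v"

definition graph_diameter :: "('a, 'b) pre_digraph \<Rightarrow> ereal" where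
  "graph_diameter G = Max {graph_dist G u v | u v. u \<in> verts G \<and> v \<in> verts G}"

definition diametral_path :: "('a, 'b) pre_digraph \<Rightarrow> 'a vwalk \<Rightarrow> bool" where
  "diametral_path G p \<longleftrightarrow> vpath p G
     \<and> ereal (real (vwalk_length p)) = graph_dist G (hd p) (last p)
     \<and> graph_dist G (hd p) (last p) = graph_diameter G"

text \<open>
  A path and its reversal are different lists, but they share vertices, so at most one of
  them can occur in a totally disjoint set.
\<close>

definition totally_disjoint_paths :: "'a vwalk set \<Rightarrow> bool" where
  "totally_disjoint_paths P \<longleftrightarrow> pairwise (\<lambda>p q. disjnt (set p) (set q)) P"

definition num_TDDP :: "('a, 'b) pre_digraph \<Rightarrow> nat" where
  "num_TDDP G = Max {card P | P. (\<forall>p\<in>P. diametral_path G p) \<and> totally_disjoint_paths P}"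

definition undirected :: "'a set \<Rightarrow> ('a \<times> 'a) set \<Rightarrow> 'a pair_pre_digraph" where
  "undirected V E = \<lparr>pverts = V, parcs = E \<union> E\<inverse>\<rparr>"

definition cycle_edges :: "nat \<Rightarrow> (nat \<times> nat) set" where
  "cycle_edges n = {(i, i + 1) | i. i < n - 1} \<union> {(n - 1, 0)}"

definition cycle_graph :: "nat \<Rightarrow> nat pair_pre_digraph" where
  "cycle_graph n = undirected {0..<n} (cycle_edges n)"

text \<open>
  In the enhanced cycle, \<open>Some i\<close> is the cycle vertex \<open>v\<^sub>i\<close> and \<open>None\<close> is the new vertex \<open>u\<close>.
  The graph is meant for odd \<open>n\<close> such that the second neighbour of \<open>u\<close>, with index
  \<open>\<lceil>n/2\<rceil> + 1\<close>, is one of the \<open>v\<^sub>0, \<dots>, v\<^sub>n\<^sub>-\<^sub>1\<close>; among the odd \<open>n > 2\<close> this fails only for \<open>n = 3\<close>.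
\<close>

definition enhanced_cycle :: "nat \<Rightarrow> nat option pair_pre_digraph" where
  "enhanced_cycle n = undirected (insert None (Some ` {0..<n}))
     (map_prod Some Some ` cycle_edges n
        \<union> {(Some (n div 2), None), (None, Some ((n + 1) div 2 + 1))})"

text \<open>The parameter is half the number of vertices.\<close>

definition chorded_cycle :: "nat \<Rightarrow> nat pair_pre_digraph" where
  "chorded_cycle n = undirected {0..<2 * n} (cycle_edges (2 * n) \<union> {(i, i + n) | i. i < n})"

text \<open>A vertex is a pair of coordinates \<open>(x, y)\<close>, so there are \<open>m\<close> rows and \<open>n\<close> columns.\<close>

definition grid_graph :: "nat \<Rightarrow> nat \<Rightarrow> (nat \<times> nat) pair_pre_digraph" where
  "grid_graph m n = undirected ({1..n} \<times> {1..m})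
     {((x, y), (x', y')) | x y x' y'. (x, y) \<in> {1..n} \<times> {1..m} \<and> (x', y') \<in> {1..n} \<times> {1..m}
        \<and> dist (real x, real y) (real x', real y') = 1}"

end

theory Submission
  imports Defs
begin

text \<open>
  A diametral path has one vertex more than the diameter, so pairwise disjoint ones are at most
  \<open>card (verts G) div (diameter + 1)\<close> in number. For complete graphs, (enhanced) cycles, chorded
  cycles, and \<open>B\<^sub>m\<^sub>,\<^sub>n\<close> with \<open>m < 2 * n\<close> this bound is attained by explicit paths. In \<open>B\<^sub>m\<^sub>,\<^sub>n\<close> with
  \<open>m \<ge> 2 * n\<close> the bound is \<open>n\<close> because every diametral path meets the side of size \<open>n\<close>. In the grid,
  diametral paths join opposite corners; two of them either share a corner or run along the two
  diagonals, and then a discrete intermediate value argument shows that they cross.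
\<close>

section \<open>Certified distances and the counting bound\<close>

text \<open>Index form of the arc set: walks given as \<open>map f [a..<b]\<close> can then be
  checked, and arbitrary walks used, position by position.\<close>

lemma set_vwalk_arcs_conv_nth:
  "set (vwalk_arcs p) = {(p ! i, p ! Suc i) | i. Suc i < length p}"
proof (induct p rule: vwalk_arcs.induct)
  case (3 x y xs)
  have "{((x # y # xs) ! i, (x # y # xs) ! Suc i) | i. Suc i < length (x # y # xs)}
      = insert (x, y) {((y # xs) ! i, (y # xs) ! Suc i) | i. Suc i < length (y # xs)}"
    (is "?L = ?R")
  proof
    show "?L \<subseteq> ?R"
    proof
      fix e assume "e \<in> ?L"
      then obtain i where i: "e = ((x # y # xs) ! i, (x # y # xs) ! Suc i)" "i \<le> length xs"
        by auto
      from i show "e \<in> ?R"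
      proof (cases i)
        case (Suc j)
        with i show ?thesis by (intro insertI2 CollectI exI[of _ j]) simp
      qed simp
    qed
    show "?R \<subseteq> ?L" by force
  qed
  with 3 show ?case by simp
qed auto

lemma vwalk_nth_arc: "vwalk p G \<Longrightarrow> Suc i < length p \<Longrightarrow> (p ! i, p ! Suc i) \<in> arcs_ends G"
  unfolding vwalk_def set_vwalk_arcs_conv_nth by blast

lemma vwalk_map_upt:
  assumes "a < b" "\<And>i. a \<le> i \<Longrightarrow> i < b \<Longrightarrow> f i \<in> verts G"
    "\<And>i. a \<le> i \<Longrightarrow> Suc i < b \<Longrightarrow> (f i, f (Suc i)) \<in> arcs_ends G"
  shows "vwalk (map f [a..<b]) G"
  using assms by (intro vwalkI) (auto simp: set_vwalk_arcs_conv_nth)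

text \<open>Reading off the \<open>Max\<close> requires a finite set of candidates. Diametral paths
  are distinct lists over finitely many vertices, so every family of them is finite and
  \<open>upper\<close> applies. The family \<open>f\<close> is injective since nonempty lists with
  disjoint vertex sets differ.\<close>

lemma num_TDDP_eqI:
  assumes fin: "finite (verts G)"
    and diam: "\<And>i. i < k \<Longrightarrow> diametral_path G (f i)"
    and disj: "\<And>i j. j < i \<Longrightarrow> i < k \<Longrightarrow> disjnt (set (f i)) (set (f j))"
    and upper: "\<And>P. finite P \<Longrightarrow> \<forall>p\<in>P. diametral_path G p \<Longrightarrow> totally_disjoint_paths P
      \<Longrightarrow> card P \<le> k"
  shows "num_TDDP G = k"
  unfolding num_TDDP_def
proof (rule Max_eqI)
  let ?S = "{card P | P. (\<forall>p\<in>P. diametral_path G p) \<and> totally_disjoint_paths P}"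
  have finP: "finite P" if "\<forall>p\<in>P. diametral_path G p" for P
  proof (rule finite_subset)
    show "P \<subseteq> {p. distinct p \<and> set p \<subseteq> verts G}"
      using that by (auto simp: diametral_path_def vpath_def vwalk_def)
    show "finite {p. distinct p \<and> set p \<subseteq> verts G}"
      using fin finite_subset_distinct by (simp add: conj_commute)
  qed
  show le: "m \<le> k" if "m \<in> ?S" for m using that finP upper by blast
  then show "finite ?S" by (meson finite_nat_set_iff_bounded_le)
  have disj': "disjnt (set (f i)) (set (f j))" if "i < k" "j < k" "i \<noteq> j" for i j
    using that disj[of i j] disj[of j i] by (cases i j rule: linorder_cases) (auto simp: disjnt_sym)
  have "f i \<noteq> []" if "i < k" for i
    using diam[OF that] by (auto simp: diametral_path_def vpath_def vwalk_def)
  then have "inj_on f {..<k}"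
    using disj' by (fastforce simp: inj_on_def disjnt_def)
  then have "card (f ` {..<k}) = k" by (simp add: card_image)
  moreover have "totally_disjoint_paths (f ` {..<k})"
    using disj' by (auto simp: totally_disjoint_paths_def pairwise_def)
  ultimately show "k \<in> ?S" using diam by (intro CollectI exI[of _ "f ` {..<k}"]) auto
qed

text \<open>
  The local conditions below certify that \<open>d\<close> is the distance function: \<open>step\<close> makes it a lower
  bound on the length of walks, \<open>pred\<close> produces walks attaining it.
\<close>

locale finite_dist_graph = wf_digraph G for G :: "('a, 'b) pre_digraph" +
  fixes d :: "'a \<Rightarrow> 'a \<Rightarrow> nat" and D :: nat
  assumes fin: "finite (verts G)"
    and refl: "u \<in> verts G \<Longrightarrow> d u u = 0"
    and step: "u \<in> verts G \<Longrightarrow> (v, w) \<in> arcs_ends G \<Longrightarrow> d u w \<le> Suc (d u v)"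
    and pred: "u \<in> verts G \<Longrightarrow> v \<in> verts G \<Longrightarrow> u \<noteq> v
      \<Longrightarrow> \<exists>w. (w, v) \<in> arcs_ends G \<and> d u v = Suc (d u w)"
    and bounded: "u \<in> verts G \<Longrightarrow> v \<in> verts G \<Longrightarrow> d u v \<le> D"
    and attained: "\<exists>u\<in>verts G. \<exists>v\<in>verts G. d u v = D"
begin

text \<open>The start \<open>v\<close> varies in the induction while the reference vertex
  \<open>u\<close> stays fixed; by \<open>step\<close>, each arc raises \<open>d u\<close> by at
  most one.\<close>

lemma awalk_lower_bound:
  "awalk v p w \<Longrightarrow> u \<in> verts G \<Longrightarrow> d u w \<le> d u v + length p"
proof (induct p arbitrary: v)
  case (Cons e p)
  then have "awalk (head G e) p w" "e \<in> arcs G" "tail G e = v" by (auto simp: awalk_Cons_iff)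
  moreover from this have "(v, head G e) \<in> arcs_ends G" by (auto simp: arcs_ends_conv)
  ultimately show ?case using Cons.hyps[of "head G e"] step[OF Cons.prems(2), of v "head G e"]
    Cons.prems by simp
qed (auto simp: awalk_Nil_iff)

lemma awalk_exists:
  "u \<in> verts G \<Longrightarrow> v \<in> verts G \<Longrightarrow> \<exists>p. awalk u p v \<and> length p = d u v"
proof (induct "d u v" arbitrary: v)
  case 0
  then have "u = v" using pred by fastforce
  then show ?case using 0 by (auto simp: awalk_Nil_iff intro!: exI[of _ "[]"])
next
  case (Suc k)
  then have "u \<noteq> v" using refl by auto
  then obtain w where w: "(w, v) \<in> arcs_ends G" "d u v = Suc (d u w)" using pred Suc by blast
  then obtain e where e: "e \<in> arcs G" "tail G e = w" "head G e = v" by (auto simp: arcs_ends_conv)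
  then have "w \<in> verts G" by auto
  with Suc w obtain p where "awalk u p w" "length p = d u w" by auto
  then show ?case using w e by (intro exI[of _ "p @ [e]"]) (auto simp: awalk_simps)
qed

text \<open>Counterpart of \<open>awalk_exists\<close> for vertex walks: distances are defined
  through arc walks, diametral paths through vertex walks. Both walks are built backwards from
  \<open>v\<close> by \<open>pred\<close>.\<close>

lemma vwalk_exists:
  "u \<in> verts G \<Longrightarrow> v \<in> verts G \<Longrightarrow> \<exists>p. vwalk p G \<and> hd p = u \<and> last p = v \<and> length p = Suc (d u v)"
proof (induct "d u v" arbitrary: v)
  case 0
  then have "u = v" using pred by fastforce
  then show ?case using 0 by (intro exI[of _ "[u]"]) (auto simp: refl)
next
  case (Suc k)
  then have "u \<noteq> v" using refl by auto
  then obtain w where w: "(w, v) \<in> arcs_ends G" "d u v = Suc (d u w)" using pred Suc by blast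
  then have "w \<in> verts G" by (auto simp: arcs_ends_conv)
  with Suc w obtain p where "vwalk p G" "hd p = u" "last p = w" "length p = Suc (d u w)" by auto
  then show ?case using w Suc.prems
    by (intro exI[of _ "p @ [v]"]) (auto simp: vwalk_def set_vwalk_arcs_snoc)
qed

lemma graph_dist_eq:
  assumes "u \<in> verts G" "v \<in> verts G"
  shows "graph_dist G u v = ereal (real (d u v))"
proof -
  have cost: "awalk_cost (\<lambda>_. 1) p = real (length p)" for p
    by (simp add: awalk_cost_def sum_list_triv)
  obtain p where "awalk u p v" "length p = d u v" using awalk_exists assms by blast
  then have "\<mu> (\<lambda>_. 1) u v \<le> ereal (real (d u v))"
    unfolding \<mu>_def by (intro INF_lower2[of p]) (auto simp: cost)
  moreover have "ereal (real (d u v)) \<le> \<mu> (\<lambda>_. 1) u v"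
    unfolding \<mu>_def using awalk_lower_bound[of u _ v u] assms
    by (intro INF_greatest) (auto simp: cost refl)
  ultimately show ?thesis by (simp add: graph_dist_def)
qed

lemma graph_diameter_eq: "graph_diameter G = ereal (real D)"
proof -
  have "{graph_dist G u v | u v. u \<in> verts G \<and> v \<in> verts G}
    = (\<lambda>(u, v). ereal (real (d u v))) ` (verts G \<times> verts G)" (is "?A = ?B")
    by (force simp: graph_dist_eq)
  moreover have "Max ?B = ereal (real D)"
    using attained bounded fin by (intro Max_eqI) force+
  ultimately show ?thesis unfolding graph_diameter_def by simp
qed

lemma vwalk_dist_le:
  assumes "vwalk p G" "u \<in> verts G" "i + j < length p"
  shows "d u (p ! (i + j)) \<le> d u (p ! i) + j"
  using assms(3)
proof (induct j)
  case (Suc j)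
  then have "(p ! (i + j), p ! (i + Suc j)) \<in> arcs_ends G"
    using vwalk_nth_arc[OF assms(1), of "i + j"] by simp
  with step[OF assms(2)] Suc show ?case by fastforce
qed simp

text \<open>The parts before and after position \<open>i\<close> contribute at most \<open>i\<close>
  and \<open>length p - 1 - i\<close> to the distance of the ends. These bounds add up to exactly
  that distance, so both are tight.\<close>

lemma geodesic_dist:
  assumes p: "vwalk p G" and len: "d (hd p) (last p) = length p - 1" and i: "i < length p"
  shows "d (hd p) (p ! i) = i"
proof -
  have ne: "p \<noteq> []" using p by auto
  then have u: "hd p \<in> verts G" using p by (auto simp: vwalk_def)
  have "d (hd p) (p ! i) \<le> i"
    using vwalk_dist_le[OF p u, of 0 i] i ne by (simp add: hd_conv_nth[symmetric] refl u)
  moreover have "d (hd p) (last p) \<le> d (hd p) (p ! i) + (length p - 1 - i)"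
    using vwalk_dist_le[OF p u, of i "length p - 1 - i"] i ne by (simp add: last_conv_nth)
  ultimately show ?thesis using len i by linarith
qed

lemma diametral_pathD:
  assumes "diametral_path G p"
  shows "vwalk p G" "distinct p" "length p = Suc D" "d (hd p) (last p) = D"
proof -
  have "vwalk p G" "distinct p" "p \<noteq> []" using assms by (auto simp: diametral_path_def vpath_def)
  moreover from this have "hd p \<in> verts G" "last p \<in> verts G" by (auto simp: vwalk_def)
  ultimately show "vwalk p G" "distinct p" "length p = Suc D" "d (hd p) (last p) = D"
    using assms by (auto simp: diametral_path_def graph_dist_eq graph_diameter_eq
        simp flip: length_greater_0_conv)
qed

lemma diametral_pathI:
  assumes p: "vwalk p G" and len: "length p = Suc D" and "d (hd p) (last p) = D"
  shows "diametral_path G p"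
proof -
  \<comment> \<open>Distinctness comes for free: vertices at different positions have different
    distances from \<open>hd p\<close>.\<close>
  have "p ! i \<noteq> p ! j" if "i < length p" "j < length p" "i \<noteq> j" for i j
    using geodesic_dist[OF p, of i] geodesic_dist[OF p, of j] that assms by auto
  then have "distinct p" by (auto simp: distinct_conv_nth)
  moreover have "hd p \<in> verts G" "last p \<in> verts G" using p by (auto simp: vwalk_def)
  ultimately show ?thesis using assms
    by (auto simp: diametral_path_def vpath_def graph_dist_eq graph_diameter_eq)
qed

lemma diametral_path_exists: "\<exists>p. diametral_path G p"
  using attained vwalk_exists diametral_pathI by metis

lemma card_diametral_paths_le:
  assumes "finite P" "\<forall>p\<in>P. diametral_path G p" "totally_disjoint_paths P"
  shows "card P * Suc D \<le> card (verts G)"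
proof -
  have "card (\<Union>p\<in>P. set p) = (\<Sum>p\<in>P. card (set p))"
    using assms by (intro card_UN_disjoint)
      (auto simp: totally_disjoint_paths_def pairwise_def disjnt_def)
  also have "\<dots> = (\<Sum>p\<in>P. Suc D)"
    using assms(2) diametral_pathD by (intro sum.cong) (auto simp: distinct_card)
  finally have "card P * Suc D = card (\<Union>p\<in>P. set p)" by simp
  also have "\<dots> \<le> card (verts G)"
    using assms(2) diametral_pathD(1) fin by (intro card_mono) (fastforce simp: vwalk_def)+
  finally show ?thesis .
qed

lemma num_TDDP_eq_by_counting:
  assumes "\<And>i. i < k \<Longrightarrow> diametral_path G (f i)"
    and "\<And>i j. j < i \<Longrightarrow> i < k \<Longrightarrow> disjnt (set (f i)) (set (f j))"
    and card: "card (verts G) < Suc k * Suc D"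
  shows "num_TDDP G = k"
proof (rule num_TDDP_eqI[OF fin assms(1,2)])
  fix P :: "'a list set"
  assume "finite P" "\<forall>p\<in>P. diametral_path G p" "totally_disjoint_paths P"
  then have "card P * Suc D < Suc k * Suc D"
    using card_diametral_paths_le card le_less_trans by blast
  then have "card P < Suc k" by (rule mult_right_less_imp_less) simp
  then show "card P \<le> k" by simp
qed

end

lemma undirected_simps [simp]:
  "pverts (undirected V E) = V"
  "parcs (undirected V E) = E \<union> E\<inverse>"
  by (simp_all add: undirected_def)

lemma wf_digraph_undirected:
  "E \<subseteq> V \<times> V \<Longrightarrow> wf_digraph (with_proj (undirected V E))"
  by unfold_locales (auto simp: undirected_def)

section \<open>Cycles\<close>

text \<open>The shorter of the two ways round the cycle; the case split keeps the subtraction of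
  naturals from truncating.\<close>

definition cycle_dist :: "nat \<Rightarrow> nat \<Rightarrow> nat \<Rightarrow> nat" where
  "cycle_dist n u v = (let e = if u \<le> v then v - u else u - v in min e (n - e))"

abbreviation cycle_arcs :: "nat \<Rightarrow> (nat \<times> nat) set" where
  "cycle_arcs n \<equiv> cycle_edges n \<union> (cycle_edges n)\<inverse>"

lemma cycle_edges_iff:
  "(v, w) \<in> cycle_edges n \<longleftrightarrow> v < n - 1 \<and> w = v + 1 \<or> v = n - 1 \<and> w = 0"
  by (auto simp: cycle_edges_def)

lemma cycle_edges_subset: "0 < n \<Longrightarrow> cycle_edges n \<subseteq> {0..<n} \<times> {0..<n}"
  by (auto simp: cycle_edges_def)

lemma cycle_dist_refl [simp]: "cycle_dist n u u = 0"
  by (simp add: cycle_dist_def)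

lemma cycle_dist_step:
  assumes "u < n" "(v, w) \<in> cycle_arcs n"
  shows "cycle_dist n u w \<le> Suc (cycle_dist n u v)"
  using assms unfolding cycle_dist_def Let_def
  by (auto simp: cycle_edges_iff min_def)

lemma cycle_dist_pos: "u < n \<Longrightarrow> v < n \<Longrightarrow> u \<noteq> v \<Longrightarrow> 0 < cycle_dist n u v"
  by (auto simp: cycle_dist_def Let_def)

lemma cycle_dist_pred:
  assumes "u < n" "v < n" "u \<noteq> v"
  shows "\<exists>w<n. (w, v) \<in> cycle_arcs n \<and> cycle_dist n u v = Suc (cycle_dist n u w)"
proof -
  let ?next = "if v = n - 1 then 0 else v + 1" and ?prev = "if v = 0 then n - 1 else v - 1"
  have arcs: "?next < n" "?prev < n" "(?next, v) \<in> cycle_arcs n" "(?prev, v) \<in> cycle_arcs n"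
    using assms by (auto simp: cycle_edges_iff)
  \<comment> \<open>The predecessor is the neighbour of \<open>v\<close> from which a shortest way
    arrives: \<open>?prev\<close> if that way runs through increasing indices (possibly past
    \<open>n - 1\<close>), \<open>?next\<close> otherwise.\<close>
  consider "u < v" "2 * (v - u) \<le> n" | "u < v" "n < 2 * (v - u)"
    | "v < u" "2 * (u - v) \<le> n" | "v < u" "n < 2 * (u - v)"
    using assms(3) by linarith
  then show ?thesis
  proof cases
    case 1
    then have "cycle_dist n u v = Suc (cycle_dist n u ?prev)"
      using assms by (auto simp: cycle_dist_def Let_def)
    with arcs show ?thesis by blast
  next
    case 2
    then have "cycle_dist n u v = Suc (cycle_dist n u ?next)"
      using assms by (auto simp: cycle_dist_def Let_def)
    with arcs show ?thesis by blast
  next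
    case 3
    then have "cycle_dist n u v = Suc (cycle_dist n u ?next)"
      using assms by (auto simp: cycle_dist_def Let_def)
    with arcs show ?thesis by blast
  next
    case 4
    then have "cycle_dist n u v = Suc (cycle_dist n u ?prev)"
      using assms by (auto simp: cycle_dist_def Let_def)
    with arcs show ?thesis by blast
  qed
qed

lemma cycle_dist_le: "cycle_dist n u v \<le> n div 2"
  unfolding cycle_dist_def Let_def min_def by simp arith

lemma finite_dist_graph_cycle:
  assumes "0 < n"
  shows "finite_dist_graph (with_proj (cycle_graph n)) (cycle_dist n) (n div 2)"
proof -
  interpret wf_digraph "with_proj (cycle_graph n)"
    unfolding cycle_graph_def using assms by (intro wf_digraph_undirected cycle_edges_subset)
  show ?thesis
  proof
    have "cycle_dist n 0 (n div 2) = n div 2" by (auto simp: cycle_dist_def Let_def)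
    then show "\<exists>u\<in>verts (with_proj (cycle_graph n)). \<exists>v\<in>verts (with_proj (cycle_graph n)).
        cycle_dist n u v = n div 2"
      unfolding cycle_graph_def using assms by (intro bexI[of _ 0] bexI[of _ "n div 2"]) auto
  next
    fix u v assume "u \<in> verts (with_proj (cycle_graph n))"
      "v \<in> verts (with_proj (cycle_graph n))" "u \<noteq> v"
    then show "\<exists>w. (w, v) \<in> arcs_ends (with_proj (cycle_graph n))
        \<and> cycle_dist n u v = Suc (cycle_dist n u w)"
      using cycle_dist_pred[of u n v] by (auto simp: cycle_graph_def)
  qed (auto simp: cycle_graph_def cycle_dist_le dest: cycle_dist_step)
qed

lemma num_TDDP_cycle:
  assumes "0 < n"
  shows "num_TDDP (with_proj (cycle_graph n)) = 1"
proof -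
  interpret finite_dist_graph "with_proj (cycle_graph n)" "cycle_dist n" "n div 2"
    using assms by (rule finite_dist_graph_cycle)
  obtain p where "diametral_path (with_proj (cycle_graph n)) p" using diametral_path_exists by blast
  then show ?thesis
    by (intro num_TDDP_eq_by_counting[of 1 "\<lambda>_. p"]) (auto simp: cycle_graph_def)
qed

section \<open>Even cycles with diameter chords\<close>

text \<open>The ends of a chord split the cycle into two halves of length \<open>n\<close>;
  \<open>u\<close> lies on one of them, so its distances to the two ends add up to
  \<open>n\<close>.\<close>

lemma chord_cycle_dist:
  assumes "u < 2 * n" "i < n"
  shows "cycle_dist (2 * n) u (i + n) = n - cycle_dist (2 * n) u i"
proof -
  consider "u \<le> i" | "i < u" "u \<le> i + n" | "i + n < u" by linarith
  then show ?thesis using assms by cases (auto simp: cycle_dist_def Let_def min_def)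
qed

text \<open>Either no chord is used, or one is: the antipode of \<open>v\<close> is at cycle
  distance \<open>n - c\<close>, and the chord costs one more. Further chords gain nothing.\<close>

definition chorded_cycle_dist :: "nat \<Rightarrow> nat \<Rightarrow> nat \<Rightarrow> nat" where
  "chorded_cycle_dist n u v = (let c = cycle_dist (2 * n) u v in min c (n + 1 - c))"

lemma chorded_cycle_dist_add:
  assumes "e \<le> n" "2 * e \<le> n + 1"
  shows "chorded_cycle_dist n u (u + e) = e"
proof -
  have "e \<le> 2 * n - e" "e \<le> n + 1 - e" using assms by linarith+
  then show ?thesis by (simp add: chorded_cycle_dist_def cycle_dist_def min_absorb1)
qed

lemma finite_dist_graph_chorded_cycle:
  assumes "1 < n"
  shows "finite_dist_graph (with_proj (chorded_cycle n)) (chorded_cycle_dist n) ((n + 1) div 2)"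
    (is "finite_dist_graph ?G ?d ?D")
proof -
  let ?c = "cycle_dist (2 * n)"
  have verts: "verts ?G = {0..<2 * n}"
    and arcs: "arcs_ends ?G = cycle_arcs (2 * n) \<union> {(i, i + n) | i. i < n} \<union> {(i + n, i) | i. i < n}"
    by (auto simp: chorded_cycle_def)
  have c_le: "?c u v \<le> n" for u v using cycle_dist_le[of "2 * n" u v] by simp
  have "cycle_edges (2 * n) \<union> {(i, i + n) | i. i < n} \<subseteq> {0..<2 * n} \<times> {0..<2 * n}"
    using assms cycle_edges_subset[of "2 * n"] by auto
  then interpret wf_digraph ?G unfolding chorded_cycle_def by (rule wf_digraph_undirected)
  show ?thesis
  proof
    have "?d 0 ?D = ?D"
      using assms chorded_cycle_dist_add[of ?D n 0] by simp
    then show "\<exists>u\<in>verts ?G. \<exists>v\<in>verts ?G. ?d u v = ?D"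
      using assms unfolding verts by (intro bexI[of _ 0] bexI[of _ ?D]) auto
  next
    fix u v w assume "u \<in> verts ?G" and vw: "(v, w) \<in> arcs_ends ?G"
    then have u: "u < 2 * n" unfolding verts by simp
    \<comment> \<open>A cycle arc changes \<open>c\<close> by at most one in either direction. A
      chord turns the two candidates \<open>c\<close> and \<open>n + 1 - c\<close> into
      \<open>n - c\<close> and \<open>c + 1\<close>, so the minimum again changes by at most
      one.\<close>
    consider "(v, w) \<in> cycle_arcs (2 * n)" | "?c u w = n - ?c u v"
      using vw chord_cycle_dist[OF u] c_le unfolding arcs by fastforce
    then show "?d u w \<le> Suc (?d u v)"
    proof cases
      case 1
      then have "?c u w \<le> Suc (?c u v)" "?c u v \<le> Suc (?c u w)"
        using cycle_dist_step[OF u] by auto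
      then show ?thesis unfolding chorded_cycle_dist_def Let_def by linarith
    next
      case 2
      then show ?thesis using c_le[of u v] unfolding chorded_cycle_dist_def Let_def by linarith
    qed
  next
    fix u v assume "u \<in> verts ?G" "v \<in> verts ?G" and ne: "u \<noteq> v"
    then have u: "u < 2 * n" and v: "v < 2 * n" unfolding verts by simp_all
    show "\<exists>w. (w, v) \<in> arcs_ends ?G \<and> ?d u v = Suc (?d u w)"
    \<comment> \<open>If the way without chords is shortest, the cycle predecessor works; otherwise
      the chord at \<open>v\<close> is taken as the last step.\<close>
    proof (cases "?c u v \<le> n + 1 - ?c u v")
      case True
      obtain w where "(w, v) \<in> cycle_arcs (2 * n)" "?c u v = Suc (?c u w)"
        using cycle_dist_pred[OF u v ne] by blast
      then show ?thesis using True unfolding arcs chorded_cycle_dist_def Let_def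
        by (intro exI[of _ w]) auto
    next
      case False
      let ?w = "if v < n then v + n else v - n"
      have "(?w, v) \<in> arcs_ends ?G" using v unfolding arcs by (auto intro!: exI[of _ "v - n"])
      moreover have "?c u ?w = n - ?c u v"
        using chord_cycle_dist[OF u, of v] chord_cycle_dist[OF u, of "v - n"] v c_le[of u "v - n"]
        by auto
      ultimately show ?thesis using False c_le[of u v] unfolding chorded_cycle_dist_def Let_def
        by (intro exI[of _ ?w]) (auto simp: min_def)
    qed
  next
    show "finite (verts ?G)" unfolding verts by simp
  qed (auto simp: chorded_cycle_dist_def Let_def)
qed

text \<open>Consecutive arcs of \<open>(n + 1) div 2 + 1\<close> vertices of the outer cycle are diametral paths.\<close>

lemma num_TDDP_chorded_cycle:
  assumes n: "1 < n" and k: "k * ((n + 1) div 2 + 1) \<le> 2 * n" "2 * n < Suc k * ((n + 1) div 2 + 1)"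
  shows "num_TDDP (with_proj (chorded_cycle n)) = k"
proof -
  let ?G = "with_proj (chorded_cycle n)"
  define D where "D = (n + 1) div 2"
  interpret finite_dist_graph ?G "chorded_cycle_dist n" D
    unfolding D_def using n by (rule finite_dist_graph_chorded_cycle)
  define f where "f i = map (\<lambda>j. i * Suc D + j) [0..<Suc D]" for i
  have D: "D \<le> n" "2 * D \<le> n + 1" using n by (auto simp: D_def)
  have kD: "k * Suc D \<le> 2 * n" "2 * n < Suc k * Suc D" using k by (simp_all add: D_def)
  have block: "Suc j * Suc D \<le> i * Suc D" if "j < i" for i j
    using that by (intro mult_le_mono1) simp
  \<comment> \<open>No block of \<open>D + 1\<close> indices reaches past \<open>2 * n - 1\<close>,
    so inside a block every step is an arc from \<open>v\<close> to \<open>v + 1\<close> and the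
    closing arc never occurs.\<close>
  have lt: "i * Suc D + j < 2 * n" if "i < k" "j \<le> D" for i j
    using block[OF that(1)] that(2) kD(1) by simp
  show ?thesis
  proof (rule num_TDDP_eq_by_counting)
    fix i assume i: "i < k"
    show "diametral_path ?G (f i)"
    proof (rule diametral_pathI)
      show "vwalk (f i) ?G" unfolding f_def
      proof (rule vwalk_map_upt)
        fix j assume "Suc j < Suc D"
        then show "(i * Suc D + j, i * Suc D + Suc j) \<in> arcs_ends ?G"
          using lt[OF i, of "Suc j"] by (auto simp: chorded_cycle_def cycle_edges_iff)
      qed (use lt[OF i] in \<open>auto simp: chorded_cycle_def\<close>)
      have "hd (f i) = i * Suc D" "last (f i) = i * Suc D + D"
        by (simp_all add: f_def hd_map last_map del: upt_Suc)
      then show "chorded_cycle_dist n (hd (f i)) (last (f i)) = D"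
        using D by (simp add: chorded_cycle_dist_add)
    qed (simp add: f_def)
  next
    fix i j :: nat assume "j < i"
    then show "disjnt (set (f i)) (set (f j))"
      using block[of j i] by (auto simp: f_def disjnt_def)
  next
    show "card (verts ?G) < Suc k * Suc D" using kD(2) by (simp add: chorded_cycle_def)
  qed
qed

section \<open>Enhanced cycles\<close>

lemma Some_Some_in_image_iff [simp]: "(Some a, Some b) \<in> map_prod Some Some ` S \<longleftrightarrow> (a, b) \<in> S"
  by force

text \<open>For \<open>n = 2 * k + 1\<close> the neighbours of the new vertex are \<open>k\<close>
  and \<open>k + 2\<close>, which are also those of \<open>k + 1\<close>. Identifying it with
  \<open>k + 1\<close> thus preserves and reflects arcs, and distances reduce to those of the cycle.
  The bound on \<open>k\<close> puts \<open>k + 2\<close> on the cycle.\<close>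

lemma enhanced_cycle_pos_iff:
  fixes v w :: "nat option" and k :: nat
  defines "pos \<equiv> case_option (Suc k) id"
  assumes "2 \<le> k"
  shows "(v, w) \<in> arcs_ends (with_proj (enhanced_cycle (Suc (2 * k))))
    \<longleftrightarrow> v \<in> insert None (Some ` {0..<Suc (2 * k)}) \<and> w \<in> insert None (Some ` {0..<Suc (2 * k)})
      \<and> (pos v, pos w) \<in> cycle_arcs (Suc (2 * k))"
  using assms by (cases v; cases w) (auto simp: enhanced_cycle_def cycle_edges_iff)

text \<open>The new vertex of the enhanced cycle is a twin of the vertex with index \<open>k + 1\<close>.\<close>

definition enhanced_cycle_dist :: "nat \<Rightarrow> nat option \<Rightarrow> nat option \<Rightarrow> nat" where
  "enhanced_cycle_dist k x y = (let pos = case_option (Suc k) id in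
     if x = y then 0 else if pos x = pos y then 2 else cycle_dist (Suc (2 * k)) (pos x) (pos y))"

lemma finite_dist_graph_enhanced_cycle:
  assumes k: "2 \<le> k"
  shows "finite_dist_graph (with_proj (enhanced_cycle (Suc (2 * k)))) (enhanced_cycle_dist k) k"
    (is "finite_dist_graph ?G ?d k")
proof -
  let ?n = "Suc (2 * k)"
  let ?pos = "case_option (Suc k) id :: nat option \<Rightarrow> nat"
  have verts: "verts ?G = insert None (Some ` {0..<?n})" by (simp add: enhanced_cycle_def)
  note arcs = enhanced_cycle_pos_iff[OF k, folded verts]
  have pos_lt: "?pos v < ?n" if "v \<in> verts ?G" for v
    using that k unfolding verts by auto
  have c_le_d: "cycle_dist ?n (?pos u) (?pos v) \<le> ?d u v" for u v
    by (auto simp: enhanced_cycle_dist_def Let_def)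
  interpret wf_digraph ?G
    unfolding enhanced_cycle_def using k cycle_edges_subset[of ?n]
    by (intro wf_digraph_undirected) auto
  show ?thesis
  proof
    have "?d (Some 0) (Some k) = k"
      using k by (auto simp: enhanced_cycle_dist_def cycle_dist_def Let_def)
    then show "\<exists>u\<in>verts ?G. \<exists>v\<in>verts ?G. ?d u v = k"
      unfolding verts by (intro bexI[of _ "Some 0"] bexI[of _ "Some k"]) auto
  next
    fix u v w assume u: "u \<in> verts ?G" and vw: "(v, w) \<in> arcs_ends ?G"
    then have v: "v \<in> verts ?G" and c: "(?pos v, ?pos w) \<in> cycle_arcs ?n"
      unfolding arcs by auto
    have ne: "?pos v \<noteq> ?pos w" using c k by (auto simp: cycle_edges_iff)
    consider "u = w" | "u \<noteq> w" "?pos u = ?pos w" | "?d u w = cycle_dist ?n (?pos u) (?pos w)"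
      unfolding enhanced_cycle_dist_def Let_def by presburger
    then show "?d u w \<le> Suc (?d u v)"
    proof cases
      \<comment> \<open>Here \<open>w\<close> is the twin of \<open>u\<close>. Since
        \<open>v\<close> is adjacent to \<open>w\<close>, it has another position than
        \<open>u\<close>, so \<open>?d u v\<close> is at least 1, while \<open>?d u w\<close> is
        2.\<close>
      case 2
      then have "0 < cycle_dist ?n (?pos u) (?pos v)"
        using ne u v by (intro cycle_dist_pos pos_lt) auto
      then show ?thesis using 2 c_le_d[of u v] by (simp add: enhanced_cycle_dist_def Let_def)
    next
      case 3
      then show ?thesis using cycle_dist_step[OF pos_lt[OF u] c] c_le_d[of u v] by simp
    qed (simp add: enhanced_cycle_dist_def)
  next
    fix u v assume u: "u \<in> verts ?G" and v: "v \<in> verts ?G" and ne: "u \<noteq> v"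
    show "\<exists>w. (w, v) \<in> arcs_ends ?G \<and> ?d u v = Suc (?d u w)"
    proof (cases "?pos u = ?pos v")
      case True
      \<comment> \<open>Only the twins share a position; their common neighbour
        \<open>Some k\<close> gives a walk of length 2.\<close>
      then have pos: "?pos u = Suc k" "?pos v = Suc k" using ne by (cases u; cases v; auto)+
      then have "(Some k, v) \<in> arcs_ends ?G"
        using v k unfolding arcs verts by (auto simp: cycle_edges_iff)
      moreover have "?d u v = Suc (?d u (Some k))"
        using pos ne k by (auto simp: enhanced_cycle_dist_def Let_def cycle_dist_def)
      ultimately show ?thesis by blast
    next
      case False
      then obtain a where a: "a < ?n" "(a, ?pos v) \<in> cycle_arcs ?n"
        "cycle_dist ?n (?pos u) (?pos v) = Suc (cycle_dist ?n (?pos u) a)"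
        using cycle_dist_pred[OF pos_lt[OF u] pos_lt[OF v]] by blast
      \<comment> \<open>At the position of \<open>u\<close> the vertex \<open>u\<close> itself must
        be chosen, because \<open>Some a\<close> could be its twin, at distance 2 instead of
        0.\<close>
      let ?w = "if a = ?pos u then u else Some a"
      have "(?w, v) \<in> arcs_ends ?G" using a(1,2) u v unfolding arcs verts by auto
      moreover have "?d u v = Suc (?d u ?w)"
        using False ne a(3) by (auto simp: enhanced_cycle_dist_def Let_def)
      ultimately show ?thesis by blast
    qed
  next
    fix u v
    show "?d u v \<le> k"
      using cycle_dist_le[of ?n "?pos u" "?pos v"] k by (auto simp: enhanced_cycle_dist_def Let_def)
  next
    show "finite (verts ?G)" unfolding verts by simp
  qed (simp add: enhanced_cycle_dist_def)
qed

lemma num_TDDP_enhanced_cycle: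
  assumes k: "2 \<le> k"
  shows "num_TDDP (with_proj (enhanced_cycle (Suc (2 * k)))) = 2"
proof -
  let ?G = "with_proj (enhanced_cycle (Suc (2 * k)))"
  interpret finite_dist_graph ?G "enhanced_cycle_dist k" k
    using k by (rule finite_dist_graph_enhanced_cycle)
  \<comment> \<open>Two paths of \<open>k + 1\<close> vertices use up all \<open>2 * k + 2\<close>
    vertices: \<open>p\<close> visits the indices 1 to \<open>k + 1\<close>; \<open>q\<close> starts
    at the twin of \<open>k + 1\<close>, runs from \<open>k + 2\<close> to \<open>2 * k\<close> and
    ends at 0.\<close>
  define p where "p = map (\<lambda>j. Some (j + 1)) [0..<Suc k]"
  define g where "g j = (if j = 0 then None else if j = k then Some 0 else Some (k + 1 + j))" for j
  define q where "q = map g [0..<Suc k]"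
  have p: "diametral_path ?G p"
  proof (rule diametral_pathI)
    show "vwalk p ?G" unfolding p_def
      using k by (intro vwalk_map_upt)
        (auto simp: enhanced_cycle_def cycle_edges_iff)
    have "hd p = Some 1" "last p = Some (k + 1)"
      by (simp_all add: p_def hd_map last_map del: upt_Suc)
    then show "enhanced_cycle_dist k (hd p) (last p) = k"
      using k by (auto simp: enhanced_cycle_dist_def cycle_dist_def Let_def)
  qed (simp add: p_def)
  have q: "diametral_path ?G q"
  proof (rule diametral_pathI)
    show "vwalk q ?G" unfolding q_def
      using k by (intro vwalk_map_upt)
        (auto simp: enhanced_cycle_def g_def cycle_edges_iff)
    have "hd q = None" "last q = Some 0"
      using k by (simp_all add: q_def g_def hd_map last_map del: upt_Suc)
    then show "enhanced_cycle_dist k (hd q) (last q) = k"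
      using k by (auto simp: enhanced_cycle_dist_def cycle_dist_def Let_def)
  qed (simp add: q_def)
  have disj: "disjnt (set q) (set p)"
    by (auto simp: p_def q_def g_def disjnt_def split: if_splits)
  have card: "card (pverts (enhanced_cycle (Suc (2 * k)))) = 2 * k + 2"
    by (simp add: enhanced_cycle_def card_image)
  show ?thesis
    using p q disj by (intro num_TDDP_eq_by_counting[of 2 "\<lambda>i. if i = 0 then p else q"])
      (auto simp: card less_2_cases_iff)
qed

section \<open>Complete and complete bipartite graphs\<close>

lemma finite_dist_graph_complete:
  assumes K: "K\<^bsub>n\<^esub> G" and n: "1 < n"
  shows "finite_dist_graph G (\<lambda>u v. if u = v then 0 else 1) 1"
proof -
  interpret graph G using K by (simp add: complete_digraph_def)
  have arcs: "arcs_ends G = {(u, v). u \<in> verts G \<and> v \<in> verts G \<and> u \<noteq> v}"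
    and card: "card (verts G) = n"
    using K by (auto simp: complete_digraph_def)
  obtain x y where "x \<in> verts G" "y \<in> verts G" "x \<noteq> y"
    using card n card_le_Suc0_iff_eq[OF finite_verts] by auto
  then show ?thesis by unfold_locales (auto simp: arcs)
qed

lemma num_TDDP_complete:
  assumes K: "K\<^bsub>n\<^esub> G" and n: "1 < n"
  shows "num_TDDP G = n div 2"
proof -
  interpret finite_dist_graph G "\<lambda>u v. if u = v then 0 else 1" 1
    using assms by (rule finite_dist_graph_complete)
  have arcs: "arcs_ends G = {(u, v). u \<in> verts G \<and> v \<in> verts G \<and> u \<noteq> v}"
    and card: "card (verts G) = n"
    using K by (auto simp: complete_digraph_def)
  obtain a where a: "bij_betw a {0..<n} (verts G)"
    using ex_bij_betw_nat_finite[OF fin] card by blast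
  have a_in: "a i \<in> verts G" if "i < n" for i using a that by (auto simp: bij_betw_def)
  have a_eq: "a i = a j \<longleftrightarrow> i = j" if "i < n" "j < n" for i j
    using a that by (auto simp: bij_betw_def inj_on_def)
  show ?thesis
  \<comment> \<open>Diametral paths are single edges here, so consecutive vertices of an enumeration
    are paired up.\<close>
  proof (rule num_TDDP_eq_by_counting[where f = "\<lambda>i. [a (2 * i), a (2 * i + 1)]"])
    fix i assume "i < n div 2"
    then have "2 * i < n" "2 * i + 1 < n" by linarith+
    then show "diametral_path G [a (2 * i), a (2 * i + 1)]"
      by (intro diametral_pathI vwalkI) (auto simp: a_in a_eq arcs)
  next
    fix i j assume ji: "j < i" and "i < n div 2"
    then have "2 * i < n" "2 * i + 1 < n" "2 * j < n" "2 * j + 1 < n" by linarith+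
    moreover have "2 * i \<noteq> 2 * j + 1" "2 * i + 1 \<noteq> 2 * j" by presburger+
    ultimately show "disjnt (set [a (2 * i), a (2 * i + 1)]) (set [a (2 * j), a (2 * j + 1)])"
      using ji by (simp add: a_eq)
  next
    show "card (verts G) < Suc (n div 2) * Suc 1" by (simp add: card)
  qed
qed

section \<open>Complete bipartite graphs\<close>

text \<open>Two vertices on the same side are joined through any vertex of the other side. The bound
  on \<open>card U\<close> provides such a pair, so that the diameter is 2 rather than 1.\<close>

lemma finite_dist_graph_complete_bipartite:
  assumes "graph G" and verts: "verts G = U \<union> V" and disj: "U \<inter> V = {}"
    and arcs: "arcs_ends G = U \<times> V \<union> V \<times> U" and card: "2 \<le> card U" "1 \<le> card V"
  shows "finite_dist_graph G (\<lambda>u v. if u = v then 0 else if u \<in> U \<longleftrightarrow> v \<in> U then 2 else 1) 2"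
    (is "finite_dist_graph G ?d 2")
proof -
  interpret graph G by fact
  have "finite U" using verts finite_verts by auto
  then obtain x x' where x: "x \<in> U" "x' \<in> U" "x \<noteq> x'"
    using card(1) card_le_Suc0_iff_eq[of U] by auto
  obtain y where y: "y \<in> V" using card(2) by fastforce
  show ?thesis
  proof
    show "\<exists>u\<in>verts G. \<exists>v\<in>verts G. ?d u v = 2"
      using x verts by (intro bexI[of _ x] bexI[of _ x']) auto
  next
    fix u v assume "u \<in> verts G" "v \<in> verts G" "u \<noteq> v"
    then show "\<exists>w. (w, v) \<in> arcs_ends G \<and> ?d u v = Suc (?d u w)"
      using x y disj unfolding arcs verts
      by (intro exI[of _ "if u \<in> U \<longleftrightarrow> v \<in> U then if u \<in> U then y else x else u"]) auto
  qed (use disj finite_verts in \<open>auto simp: verts arcs\<close>)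
qed

text \<open>
  The witness consists of \<open>p\<close> paths with both ends in \<open>U\<close> and \<open>q\<close> paths with both ends in \<open>V\<close>.
\<close>

lemma complete_bipartite_diametral_paths:
  assumes "graph G" and verts: "verts G = U \<union> V" and disj: "U \<inter> V = {}"
    and arcs: "arcs_ends G = U \<times> V \<union> V \<times> U" and card: "2 \<le> card U" "1 \<le> card V"
    and pq: "2 * p + q \<le> card U" "p + 2 * q \<le> card V"
  shows "\<exists>f. (\<forall>i<p + q. diametral_path G (f i))
    \<and> (\<forall>i<p + q. \<forall>j<i. disjnt (set (f i)) (set (f j)))"
proof -
  interpret finite_dist_graph G
    "\<lambda>u v. if u = v then 0 else if u \<in> U \<longleftrightarrow> v \<in> U then 2 else 1" 2
    by (rule finite_dist_graph_complete_bipartite) fact+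
  have "finite U" "finite V" using fin verts by auto
  then obtain a b where a: "bij_betw a {0..<card U} U" and b: "bij_betw b {0..<card V} V"
    by (meson ex_bij_betw_nat_finite)
  have a_in: "a i \<in> U" if "i < card U" for i using a that by (auto simp: bij_betw_def)
  have b_in: "b i \<in> V" "b i \<notin> U" if "i < card V" for i
    using b that disj by (auto simp: bij_betw_def)
  have a_eq: "a i = a j \<longleftrightarrow> i = j" if "i < card U" "j < card U" for i j
    using a that by (auto simp: bij_betw_def inj_on_def)
  have b_eq: "b i = b j \<longleftrightarrow> i = j" if "i < card V" "j < card V" for i j
    using b that by (auto simp: bij_betw_def inj_on_def)
  have ab: "a i \<noteq> b j" "b j \<noteq> a i" if "i < card U" "j < card V" for i j
    using a_in b_in that by metis+
  \<comment> \<open>The first \<open>p\<close> paths take their ends from \<open>a\<close> at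
    indices below \<open>2 * p\<close> and their centres from \<open>b\<close> below
    \<open>p\<close>. The other \<open>q\<close> paths continue from there, with centres from
    \<open>a\<close> and ends from \<open>b\<close>.\<close>
  define f where "f i = (if i < p then [a (2 * i), b i, a (2 * i + 1)]
    else [b (p + 2 * (i - p)), a (2 * p + (i - p)), b (p + 2 * (i - p) + 1)])" for i
  have odd: "2 * i \<noteq> Suc (2 * j)" "Suc (2 * i) \<noteq> 2 * j" for i j :: nat by presburger+
  show ?thesis
  proof (intro exI[of _ f] conjI allI impI)
    fix i assume i: "i < p + q"
    show "diametral_path G (f i)"
    proof (cases "i < p")
      case True
      then have "2 * i < card U" "2 * i + 1 < card U" "i < card V" using pq by linarith+
      then show ?thesis using True
        by (intro diametral_pathI vwalkI) (auto simp: f_def a_in b_in a_eq arcs verts)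
    next
      case False
      then have "p + 2 * (i - p) + 1 < card V" "2 * p + (i - p) < card U" using pq i by linarith+
      then show ?thesis using False
        by (intro diametral_pathI vwalkI) (auto simp: f_def a_in b_in b_eq arcs verts)
    qed
  next
    fix i j assume ji: "i < p + q" "j < i"
    consider "i < p" | "j < p" "p \<le> i" | "p \<le> j" using ji by linarith
    then show "disjnt (set (f i)) (set (f j))"
    proof cases
      case 1
      then have "2 * i + 1 < card U" "2 * j + 1 < card U" "i < card V" "j < card V"
        using pq ji by linarith+
      then show ?thesis using 1 ji odd by (simp add: f_def a_eq b_eq ab)
    next
      case 2
      then have "p + 2 * (i - p) + 1 < card V" "2 * p + (i - p) < card U"
        "2 * j + 1 < card U" "j < card V" "2 * j + 1 < 2 * p + (i - p)" "j < p + 2 * (i - p)"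
        using pq ji by linarith+
      then show ?thesis using 2 ji by (simp add: f_def a_eq b_eq ab)
    next
      case 3
      then obtain i' j' where "i = p + i'" "j = p + j'" using ji by (metis less_imp_le le_Suc_ex le_trans)
      moreover from this have "p + 2 * i' + 1 < card V" "2 * p + i' < card U"
        "p + 2 * j' + 1 < card V" "2 * p + j' < card U" "j' < i'"
        using pq ji by linarith+
      ultimately show ?thesis using odd by (simp add: f_def a_eq b_eq ab)
    qed
  qed
qed

lemma num_TDDP_complete_bipartite:
  assumes K: "K\<^bsub>m,n\<^esub> G" and mn: "1 \<le> n" "n \<le> m" "(m, n) \<noteq> (1, 1)"
  shows "num_TDDP G = (if 2 * n \<le> m then n else (m + n) div 3)"
proof -
  from K obtain U V where G: "graph G" "verts G = U \<union> V" "U \<inter> V = {}"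
    "arcs_ends G = U \<times> V \<union> V \<times> U" and UV: "card U = m" "card V = n"
    by (auto simp: complete_bipartite_digraph_def)
  have card: "2 \<le> card U" "1 \<le> card V" using mn UV by auto
  note G' = G card
  interpret finite_dist_graph G
    "\<lambda>u v. if u = v then 0 else if u \<in> U \<longleftrightarrow> v \<in> U then 2 else 1" 2
    using G' by (rule finite_dist_graph_complete_bipartite)
  have finV: "finite V" using fin G(2) by auto
  show ?thesis
  proof (cases "2 * n \<le> m")
    case True
    \<comment> \<open>The first arc of a path of three vertices joins the two sides, so one of its
      ends lies in \<open>V\<close>.\<close>
    have meets: "set p \<inter> V \<noteq> {}" if "diametral_path G p" for p
    proof -
      have len: "length p = 3" using diametral_pathD(3)[OF that] by simp
      then have "(p ! 0, p ! 1) \<in> arcs_ends G"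
        using vwalk_nth_arc[OF diametral_pathD(1)[OF that], of 0] by simp
      then have "p ! 0 \<in> V \<or> p ! 1 \<in> V" "p ! 0 \<in> set p" "p ! 1 \<in> set p"
        using G(4) len by auto
      then show ?thesis by blast
    qed
    have "\<exists>f. (\<forall>i<n. diametral_path G (f i)) \<and> (\<forall>i<n. \<forall>j<i. disjnt (set (f i)) (set (f j)))"
      using complete_bipartite_diametral_paths[OF G', where p = n and q = 0] True UV by simp
    then obtain f where f: "\<forall>i<n. diametral_path G (f i)"
      "\<forall>i<n. \<forall>j<i. disjnt (set (f i)) (set (f j))"
      by (elim exE conjE)
    have "num_TDDP G = n"
    proof (rule num_TDDP_eqI[OF fin, of n f])
      fix P assume P: "\<forall>p\<in>P. diametral_path G p" "totally_disjoint_paths P"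
      \<comment> \<open>Choosing a vertex of \<open>V\<close> on each path is injective by
        disjointness, which bounds the family by \<open>card V\<close>.\<close>
      define g where "g p = (SOME x. x \<in> set p \<inter> V)" for p
      have g: "g p \<in> set p \<inter> V" if "p \<in> P" for p
        unfolding g_def using meets P(1) that by (metis (mono_tags) ex_in_conv someI_ex)
      then have "inj_on g P"
        using P(2) by (fastforce simp: inj_on_def totally_disjoint_paths_def pairwise_def disjnt_def)
      moreover have "g ` P \<subseteq> V" using g by auto
      ultimately show "card P \<le> n" using card_inj_on_le finV UV(2) by blast
    qed (use f in auto)
    then show ?thesis using True by simp
  next
    case False
    define t where "t = (m + n) div 3"
    \<comment> \<open>With \<open>p + q = t\<close> the demands on the sides read
      \<open>p \<le> m - t\<close> and \<open>2 * t - p \<le> n\<close>, so \<open>p\<close> is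
      taken as large as possible. If \<open>p = t\<close>, the second follows from
      \<open>m < 2 * n\<close>; if \<open>p = m - t\<close>, it is
      \<open>3 * t \<le> m + n\<close>.\<close>
    define p where "p = min t (m - t)"
    define q where "q = t - p"
    have pq: "p + q = t" "2 * p + q \<le> m" "p + 2 * q \<le> n"
    proof -
      have t: "3 * t \<le> m + n" unfolding t_def by simp
      then have "t \<le> m" using mn by linarith
      show "p + q = t" unfolding q_def p_def by simp
      show "2 * p + q \<le> m" "p + 2 * q \<le> n"
        using False t \<open>t \<le> m\<close> unfolding q_def p_def by linarith+
    qed
    have "\<exists>f. (\<forall>i<t. diametral_path G (f i)) \<and> (\<forall>i<t. \<forall>j<i. disjnt (set (f i)) (set (f j)))"
      using complete_bipartite_diametral_paths[OF G', where p = p and q = q] pq UV by simp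
    then obtain f where f: "\<forall>i<t. diametral_path G (f i)"
      "\<forall>i<t. \<forall>j<i. disjnt (set (f i)) (set (f j))"
      by (elim exE conjE)
    have "card (verts G) = m + n"
      using G UV fin by (simp add: card_Un_disjoint)
    then have "card (verts G) < Suc t * Suc 2" unfolding t_def by simp
    then have "num_TDDP G = t" using f by (intro num_TDDP_eq_by_counting[of t f]) simp_all
    then show ?thesis using False t_def by simp
  qed
qed

section \<open>Grids\<close>

text \<open>The Manhattan distance, computed over the integers to avoid truncated
  subtraction.\<close>

definition grid_dist :: "nat \<times> nat \<Rightarrow> nat \<times> nat \<Rightarrow> nat" where
  "grid_dist u v = nat (\<bar>int (fst u) - int (fst v)\<bar> + \<bar>int (snd u) - int (snd v)\<bar>)"

lemma grid_dist_eq_1D: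
  assumes "grid_dist v w = 1"
  obtains "fst w = fst v" "snd w = Suc (snd v)" | "fst w = fst v" "snd v = Suc (snd w)"
    | "snd w = snd v" "fst w = Suc (fst v)" | "snd w = snd v" "fst v = Suc (fst w)"
proof -
  have "\<bar>int (fst v) - int (fst w)\<bar> + \<bar>int (snd v) - int (snd w)\<bar> = 1"
    using assms by (simp add: grid_dist_def)
  then show thesis using that by linarith
qed

text \<open>Links Euclidean distance 1, which defines adjacency in the grid, to Manhattan distance
  1: both force one coordinate to be 0 and the other to be 1 or -1.\<close>

lemma sum_squares_eq_1_iff: "a\<^sup>2 + b\<^sup>2 = 1 \<longleftrightarrow> \<bar>a\<bar> + \<bar>b\<bar> = 1" for a b :: int
proof
  assume eq: "a\<^sup>2 + b\<^sup>2 = 1"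
  have "\<bar>c\<bar> \<le> 1" if "c\<^sup>2 \<le> 1" for c :: int
    using that by (simp add: abs_square_le_1)
  moreover have "a\<^sup>2 \<le> 1" "b\<^sup>2 \<le> 1" using eq zero_le_power2[of a] zero_le_power2[of b] by linarith+
  ultimately have "\<bar>a\<bar> \<le> 1" "\<bar>b\<bar> \<le> 1" by blast+
  then have "a \<in> {-1, 0, 1}" "b \<in> {-1, 0, 1}" by auto
  then show "\<bar>a\<bar> + \<bar>b\<bar> = 1" using eq by auto
next
  assume "\<bar>a\<bar> + \<bar>b\<bar> = 1"
  then consider "a = 0" "\<bar>b\<bar> = 1" | "b = 0" "\<bar>a\<bar> = 1" by linarith
  then show "a\<^sup>2 + b\<^sup>2 = 1" by cases (auto simp: abs_square_eq_1)
qed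

lemma dist_eq_1_iff:
  "dist (real x, real y) (real x', real y') = 1 \<longleftrightarrow> grid_dist (x, y) (x', y') = 1"
proof -
  let ?a = "int x - int x'" and ?b = "int y - int y'"
  have "(dist (real x) (real x'))\<^sup>2 + (dist (real y) (real y'))\<^sup>2 = of_int (?a\<^sup>2 + ?b\<^sup>2)"
    by (simp add: dist_real_def)
  then have "dist (real x, real y) (real x', real y') = 1 \<longleftrightarrow> of_int (?a\<^sup>2 + ?b\<^sup>2) = (1 :: real)"
    by (simp only: dist_Pair_Pair real_sqrt_eq_1_iff)
  also have "\<dots> \<longleftrightarrow> \<bar>?a\<bar> + \<bar>?b\<bar> = 1" by (simp only: of_int_eq_1_iff sum_squares_eq_1_iff)
  finally show ?thesis by (auto simp: grid_dist_def)
qed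

lemma verts_grid_graph: "verts (with_proj (grid_graph m n)) = {1..n} \<times> {1..m}"
  by (simp add: grid_graph_def)

lemma arcs_ends_grid_graph:
  "(v, w) \<in> arcs_ends (with_proj (grid_graph m n))
    \<longleftrightarrow> v \<in> {1..n} \<times> {1..m} \<and> w \<in> {1..n} \<times> {1..m} \<and> grid_dist v w = 1"
proof -
  have "grid_dist w v = grid_dist v w" by (simp add: grid_dist_def abs_minus_commute)
  then show ?thesis by (cases v; cases w) (auto simp: grid_graph_def dist_eq_1_iff)
qed

lemma finite_dist_graph_grid:
  assumes "1 \<le> m" "1 \<le> n"
  shows "finite_dist_graph (with_proj (grid_graph m n)) grid_dist (n - 1 + (m - 1))"
    (is "finite_dist_graph ?G _ ?D")
proof -
  interpret wf_digraph ?G unfolding grid_graph_def by (rule wf_digraph_undirected) auto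
  show ?thesis
  proof
    have "grid_dist (1, 1) (n, m) = ?D" using assms by (simp add: grid_dist_def nat_add_distrib)
    then show "\<exists>u\<in>verts ?G. \<exists>v\<in>verts ?G. grid_dist u v = ?D"
      using assms unfolding verts_grid_graph by (intro bexI[of _ "(1, 1)"] bexI[of _ "(n, m)"]) auto
  next
    fix u v w assume "(v, w) \<in> arcs_ends ?G"
    then have "grid_dist v w = 1" unfolding arcs_ends_grid_graph by simp
    then show "grid_dist u w \<le> Suc (grid_dist u v)" unfolding grid_dist_def by linarith
  next
    fix u v assume u: "u \<in> verts ?G" and v: "v \<in> verts ?G" and ne: "u \<noteq> v"
    obtain a b x y where uv: "u = (a, b)" "v = (x, y)" by (cases u; cases v)
    \<comment> \<open>One step from \<open>v\<close> towards \<open>u\<close>, horizontally as long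
      as the columns differ.\<close>
    define w where "w = (if x < a then (x + 1, y) else if a < x then (x - 1, y)
      else if y < b then (x, y + 1) else (x, y - 1))"
    have in_range: "a \<in> {1..n}" "b \<in> {1..m}" "x \<in> {1..n}" "y \<in> {1..m}"
      using u v unfolding verts_grid_graph uv by auto
    consider "x < a" | "a < x" | "x = a" "y < b" | "x = a" "b < y"
      using ne uv by fastforce
    then have "w \<in> {1..n} \<times> {1..m} \<and> grid_dist w v = 1 \<and> grid_dist u v = Suc (grid_dist u w)"
      using in_range by cases (auto simp: w_def uv grid_dist_def)
    then show "\<exists>w. (w, v) \<in> arcs_ends ?G \<and> grid_dist u v = Suc (grid_dist u w)"
      using v unfolding arcs_ends_grid_graph verts_grid_graph by blast
  next
    fix u v assume "u \<in> verts ?G" "v \<in> verts ?G"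
    then show "grid_dist u v \<le> ?D"
      unfolding verts_grid_graph grid_dist_def by (cases u; cases v) auto
  next
    show "finite (verts ?G)" unfolding verts_grid_graph by simp
  qed (simp add: grid_dist_def)
qed

text \<open>
  Let \<open>p\<close> run from \<open>(1, 1)\<close> to \<open>(n, m)\<close>; then \<open>p ! t\<close> is its unique vertex on the antidiagonal
  \<open>x + y = t + 2\<close>. Along \<open>q\<close>, the signed horizontal offset from the vertex of \<open>p\<close> on the same
  antidiagonal changes by at most 1 in each step and changes sign, so it vanishes somewhere.
\<close>

lemma grid_diagonals_meet:
  assumes mn: "1 \<le> m" "1 \<le> n"
    and p: "vwalk p (with_proj (grid_graph m n))" "length p = Suc (n - 1 + (m - 1))"
      "hd p = (1, 1)" "last p = (n, m)"
    and q: "vwalk q (with_proj (grid_graph m n))" "hd q = (1, m)" "last q = (n, 1)"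
  shows "set p \<inter> set q \<noteq> {}"
proof -
  let ?G = "with_proj (grid_graph m n)" and ?D = "n - 1 + (m - 1)"
  interpret finite_dist_graph ?G grid_dist ?D
    using mn by (rule finite_dist_graph_grid)
  have p_in: "p ! t \<in> {1..n} \<times> {1..m}" if "t \<le> ?D" for t
    using vwalk_verts_in_verts[OF p(1), of "p ! t", unfolded verts_grid_graph] p(2) that by simp
  have q_in: "q ! i \<in> {1..n} \<times> {1..m}" if "i < length q" for i
    using vwalk_verts_in_verts[OF q(1), of "q ! i", unfolded verts_grid_graph] that by simp
  have "grid_dist (hd p) (last p) = length p - 1"
    using mn p by (simp add: grid_dist_def nat_add_distrib)
  note dist_p = geodesic_dist[OF p(1) this]
  have sum_p: "fst (p ! t) + snd (p ! t) = t + 2" if "t \<le> ?D" for t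
  proof -
    have "grid_dist (1, 1) (p ! t) = t" using dist_p[of t] that p(2,3) by simp
    moreover have "1 \<le> fst (p ! t)" "1 \<le> snd (p ! t)" using p_in[OF that] by (auto simp: mem_Times_iff)
    ultimately show ?thesis by (simp add: grid_dist_def)
  qed
  define x where "x t = int (fst (p ! t))" for t
  have x_step: "x t \<le> x (Suc t) \<and> x (Suc t) \<le> x t + 1" if "Suc t \<le> ?D" for t
  proof -
    have "(p ! t, p ! Suc t) \<in> arcs_ends ?G"
      using p(1) by (rule vwalk_nth_arc) (use p(2) that in simp)
    then have "grid_dist (p ! t) (p ! Suc t) = 1" unfolding arcs_ends_grid_graph by simp
    then show ?thesis
      using sum_p[of t] sum_p[of "Suc t"] that by (cases rule: grid_dist_eq_1D) (auto simp: x_def)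
  qed
  \<comment> \<open>\<open>s i\<close> numbers the antidiagonal through \<open>q ! i\<close>, and is
    therefore the position at which \<open>p\<close> crosses it.\<close>
  define s where "s i = fst (q ! i) + snd (q ! i) - 2" for i
  have s_le: "s i \<le> ?D" and s_eq: "fst (q ! i) + snd (q ! i) = s i + 2" if "i < length q" for i
    using q_in[OF that] unfolding s_def by (auto simp: mem_Times_iff)
  define f where "f i = int (fst (q ! i)) - x (s i)" for i
  have q_ne: "q \<noteq> []" using q(1) by auto
  have "\<bar>f (i + 1) - f i\<bar> \<le> 1" if "i < length q - 1" for i
  proof -
    have i: "i < length q" "Suc i < length q" using that by auto
    then have "(q ! i, q ! Suc i) \<in> arcs_ends ?G"
      using vwalk_nth_arc[OF q(1)] by blast
    then have d: "grid_dist (q ! i) (q ! Suc i) = 1" unfolding arcs_ends_grid_graph by simp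
    note sums = s_eq[OF i(1)] s_eq[OF i(2)] and steps = x_step[of "s i"] x_step[of "s (Suc i)"]
      and le = s_le[OF i(1)] s_le[OF i(2)]
    \<comment> \<open>When \<open>q\<close> moves up or right, \<open>s\<close> grows by one and
      \<open>x\<close> by 0 or 1. The column of \<open>q\<close> stays fixed or grows by 1
      respectively, so \<open>f\<close> changes by at most one. Moves down or left are
      symmetric.\<close>
    from d show ?thesis
    proof (cases rule: grid_dist_eq_1D)
      case 1
      moreover from this have "s (Suc i) = Suc (s i)" using sums by simp
      ultimately show ?thesis using steps(1) le unfolding f_def by simp
    next
      case 2
      moreover from this have "s i = Suc (s (Suc i))" using sums by simp
      ultimately show ?thesis using steps(2) le unfolding f_def by simp
    next
      case 3
      moreover from this have "s (Suc i) = Suc (s i)" using sums by simp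
      ultimately show ?thesis using steps(1) le unfolding f_def by simp
    next
      case 4
      moreover from this have "s i = Suc (s (Suc i))" using sums by simp
      ultimately show ?thesis using steps(2) le unfolding f_def by simp
    qed
  qed
  \<comment> \<open>\<open>q\<close> starts in the leftmost column and ends in the rightmost one, so
    it begins weakly left and finishes weakly right of \<open>p\<close>.\<close>
  moreover have "f 0 \<le> 0"
  proof -
    have "fst (q ! 0) = 1" using q(2) q_ne by (simp add: hd_conv_nth)
    moreover have "1 \<le> fst (p ! s 0)" using p_in[OF s_le[of 0]] q_ne by (simp add: mem_Times_iff)
    ultimately show ?thesis by (simp add: f_def x_def)
  qed
  moreover have "0 \<le> f (length q - 1)"
  proof -
    have "fst (q ! (length q - 1)) = n" using q(3) q_ne by (simp add: last_conv_nth)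
    moreover have "fst (p ! s (length q - 1)) \<le> n"
      using p_in[OF s_le[of "length q - 1"]] q_ne by (simp add: mem_Times_iff)
    ultimately show ?thesis by (simp add: f_def x_def)
  qed
  ultimately obtain i where "i \<le> length q - 1" "f i = 0"
    using nat0_intermed_int_val[of "length q - 1" f 0] by auto
  moreover from this have i: "i < length q"
    using q_ne by (metis diff_less le_less_trans length_greater_0_conv zero_less_one)
  ultimately have "q ! i = p ! s i"
    using s_eq[OF i] sum_p[OF s_le[OF i]] by (simp add: f_def x_def prod_eq_iff)
  moreover have "p ! s i \<in> set p" using s_le[OF i] p(2) by simp
  ultimately show ?thesis using nth_mem[OF i] by auto
qed

lemma vwalk_rev_undirected:
  "vwalk p (with_proj (undirected V E)) \<Longrightarrow> vwalk (rev p) (with_proj (undirected V E))"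
  by (auto simp: vwalk_def set_vwalk_arcs_rev)

text \<open>The coordinate differences of the ends are at most \<open>n - 1\<close> and
  \<open>m - 1\<close> and sum to the maximum, so both are extremal and the ends are opposite
  corners. Reversing the path if necessary makes it start in column 1.\<close>

lemma grid_diametral_path_cases:
  assumes mn: "1 \<le> m" "1 \<le> n" and p: "diametral_path (with_proj (grid_graph m n)) p"
  obtains p' where "set p' = set p" "vwalk p' (with_proj (grid_graph m n))"
    "length p' = Suc (n - 1 + (m - 1))"
    "hd p' = (1, 1) \<and> last p' = (n, m) \<or> hd p' = (1, m) \<and> last p' = (n, 1)"
proof -
  let ?G = "with_proj (grid_graph m n)" and ?D = "n - 1 + (m - 1)"
  interpret finite_dist_graph ?G grid_dist ?D
    using mn by (rule finite_dist_graph_grid)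
  note pD = diametral_pathD[OF p]
  have ne: "p \<noteq> []" using pD by auto
  have in_verts: "hd p \<in> {1..n} \<times> {1..m}" "last p \<in> {1..n} \<times> {1..m}"
    using vwalk_verts_in_verts[OF pD(1), unfolded verts_grid_graph] ne by simp_all
  obtain a b c e where ends: "hd p = (a, b)" "last p = (c, e)" by fastforce
  have bounds: "1 \<le> a" "a \<le> n" "1 \<le> c" "c \<le> n" "1 \<le> b" "b \<le> m" "1 \<le> e" "e \<le> m"
    using in_verts ends by auto
  have "\<bar>int a - int c\<bar> + \<bar>int b - int e\<bar> = int n - 1 + (int m - 1)"
    using pD(4) mn unfolding ends grid_dist_def by auto
  moreover have "\<bar>int a - int c\<bar> \<le> int n - 1" "\<bar>int b - int e\<bar> \<le> int m - 1"
    using bounds by linarith+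
  ultimately have "\<bar>int a - int c\<bar> = int n - 1" "\<bar>int b - int e\<bar> = int m - 1" by linarith+
  then have x: "a = 1 \<and> c = n \<or> a = n \<and> c = 1" and y: "b = 1 \<and> e = m \<or> b = m \<and> e = 1"
    using bounds by linarith+
  show thesis
  proof (cases "a = 1 \<and> c = n")
    case True
    then show thesis using that[of p] pD ends y by auto
  next
    case False
    have "vwalk (rev p) ?G" using pD(1) unfolding grid_graph_def by (rule vwalk_rev_undirected)
    then show thesis using that[of "rev p"] pD ends x y False ne by (auto simp: hd_rev last_rev)
  qed
qed

text \<open>Once both paths are oriented to start in column 1, they either share their first corner
  or run along different diagonals and cross.\<close>

lemma grid_diametral_paths_meet:
  assumes mn: "1 \<le> m" "1 \<le> n"
    and p: "diametral_path (with_proj (grid_graph m n)) p"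
    and q: "diametral_path (with_proj (grid_graph m n)) q"
  shows "set p \<inter> set q \<noteq> {}"
proof -
  obtain p' where p': "set p' = set p" "vwalk p' (with_proj (grid_graph m n))"
    "length p' = Suc (n - 1 + (m - 1))"
    "hd p' = (1, 1) \<and> last p' = (n, m) \<or> hd p' = (1, m) \<and> last p' = (n, 1)"
    using grid_diametral_path_cases[OF mn p] by metis
  obtain q' where q': "set q' = set q" "vwalk q' (with_proj (grid_graph m n))"
    "length q' = Suc (n - 1 + (m - 1))"
    "hd q' = (1, 1) \<and> last q' = (n, m) \<or> hd q' = (1, m) \<and> last q' = (n, 1)"
    using grid_diametral_path_cases[OF mn q] by metis
  have "p' \<noteq> []" "q' \<noteq> []" using p'(3) q'(3) by auto
  then have hd: "hd p' \<in> set p" "hd q' \<in> set q" using p'(1) q'(1) hd_in_set by blast+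
  consider "hd p' = hd q'" | "hd p' = (1, 1)" "last p' = (n, m)" "hd q' = (1, m)" "last q' = (n, 1)"
    | "hd q' = (1, 1)" "last q' = (n, m)" "hd p' = (1, m)" "last p' = (n, 1)"
    using p'(4) q'(4) by metis
  then show ?thesis
  proof cases
    case 1
    then show ?thesis using hd by auto
  next
    case 2
    then show ?thesis using grid_diagonals_meet[OF mn p'(2,3) _ _ q'(2)] p'(1) q'(1) by auto
  next
    case 3
    then show ?thesis using grid_diagonals_meet[OF mn q'(2,3) _ _ p'(2)] p'(1) q'(1) by auto
  qed
qed

lemma num_TDDP_grid:
  assumes mn: "1 \<le> m" "1 \<le> n"
  shows "num_TDDP (with_proj (grid_graph m n)) = 1"
proof -
  interpret finite_dist_graph "with_proj (grid_graph m n)" grid_dist "n - 1 + (m - 1)"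
    using mn by (rule finite_dist_graph_grid)
  obtain p where "diametral_path (with_proj (grid_graph m n)) p" using diametral_path_exists by blast
  then show ?thesis
  proof (intro num_TDDP_eqI[OF fin, of 1 "\<lambda>_. p"])
    fix P assume "finite P" "\<forall>p\<in>P. diametral_path (with_proj (grid_graph m n)) p"
      "totally_disjoint_paths P"
    then have "p = q" if "p \<in> P" "q \<in> P" for p q
      using grid_diametral_paths_meet[OF mn, of p q] that
      by (auto simp: totally_disjoint_paths_def pairwise_def disjnt_def)
    then show "card P \<le> 1" using \<open>finite P\<close> by (simp add: card_le_Suc0_iff_eq)
  qed auto
qed

theorem theorem3:
  shows
    "(\<forall>n>1. \<forall>G :: ('a, 'b) pre_digraph. K\<^bsub>n\<^esub> G \<longrightarrow> num_TDDP G = n div 2)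
   \<and> (\<forall>n>2. num_TDDP (with_proj (cycle_graph n)) = 1)
   \<and> (\<forall>n>2. odd n \<and> (n + 1) div 2 + 1 < n \<longrightarrow> num_TDDP (with_proj (enhanced_cycle n)) = 2)
   \<and> (\<forall>n. (2 < n \<and> n < 6 \<or> n = 7 \<longrightarrow> num_TDDP (with_proj (chorded_cycle n)) = 2)
        \<and> (n \<ge> 6 \<and> n \<noteq> 7 \<longrightarrow> num_TDDP (with_proj (chorded_cycle n)) = 3))
   \<and> (\<forall>m\<ge>1. \<forall>n\<ge>1. num_TDDP (with_proj (grid_graph m n)) = 1)
   \<and> (\<forall>m n. \<forall>G :: ('a, 'b) pre_digraph. n \<ge> 1 \<and> m \<ge> n \<and> (m, n) \<noteq> (1, 1) \<and> K\<^bsub>m,n\<^esub> G \<longrightarrow>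
        (m \<ge> 2 * n \<longrightarrow> num_TDDP G = n) \<and> (m < 2 * n \<longrightarrow> num_TDDP G = (m + n) div 3))"
proof (intro conjI allI impI)
  fix n :: nat and G :: "('a, 'b) pre_digraph" assume "1 < n" "K\<^bsub>n\<^esub> G"
  then show "num_TDDP G = n div 2" by (intro num_TDDP_complete)
next
  fix n :: nat assume "2 < n"
  then show "num_TDDP (with_proj (cycle_graph n)) = 1" by (intro num_TDDP_cycle) simp
next
  fix n :: nat assume "2 < n" "odd n \<and> (n + 1) div 2 + 1 < n"
  \<comment> \<open>In terms of \<open>k\<close>, the bound \<open>(n + 1) div 2 + 1 < n\<close>
    says \<open>2 \<le> k\<close>.\<close>
  moreover from this obtain k where "n = Suc (2 * k)" by (auto elim: oddE)
  ultimately show "num_TDDP (with_proj (enhanced_cycle n)) = 2"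
    using num_TDDP_enhanced_cycle[of k] by simp
next
  fix n :: nat assume "2 < n \<and> n < 6 \<or> n = 7"
  then have "n \<in> {3, 4, 5, 7}" by auto
  then show "num_TDDP (with_proj (chorded_cycle n)) = 2"
    by (intro num_TDDP_chorded_cycle) auto
next
  fix n :: nat assume n: "n \<ge> 6 \<and> n \<noteq> 7"
  define D where "D = (n + 1) div 2"
  have "2 * D = n \<or> 2 * D = n + 1" unfolding D_def by presburger
  \<comment> \<open>For even \<open>n\<close> the first inequality amounts to
    \<open>6 \<le> n\<close>, for odd \<open>n\<close> to \<open>9 \<le> n\<close>; this is why 7 is
    exceptional.\<close>
  then have "3 * (D + 1) \<le> 2 * n" "2 * n < 4 * (D + 1)" using n by presburger+
  then show "num_TDDP (with_proj (chorded_cycle n)) = 3"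
    using n unfolding D_def by (intro num_TDDP_chorded_cycle) auto
next
  fix m n :: nat assume "1 \<le> m" "1 \<le> n"
  then show "num_TDDP (with_proj (grid_graph m n)) = 1" by (rule num_TDDP_grid)
next
  fix m n :: nat and G :: "('a, 'b) pre_digraph"
  assume "n \<ge> 1 \<and> m \<ge> n \<and> (m, n) \<noteq> (1, 1) \<and> K\<^bsub>m,n\<^esub> G"
  then have *: "num_TDDP G = (if 2 * n \<le> m then n else (m + n) div 3)"
    by (intro num_TDDP_complete_bipartite) auto
  show "num_TDDP G = n" if "m \<ge> 2 * n" using * that by simp
  show "num_TDDP G = (m + n) div 3" if "m < 2 * n" using * that by simp
qed

end
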